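(* Let $1<p,q<\infty$ with $\frac1p+\frac1q=1$, and let $f,g\ge 0$ be measurable functions on $\mathbb{R}^n$ satisfying $$0<\int f^p\,dx<\infty,\qquad 0<\int g^q\,dx<\infty .$$ Define $F=f^p$, $G=g^q$ and, for $0\le\theta\le1$, $$Z(\theta)=\int F^{1-\theta}G^{\theta}\,dx,\qquad d\mu_\theta=\frac{F^{1-\theta}G^{\theta}}{Z(\theta)}\,dx .$$ Then $$\log\frac{\|f\|_{L^p}\,\|g\|_{L^q}}{\int fg\,dx}=\int_0^1 K_{1/q}(s)\,\operatorname{Var}_{\mu_s}\!\left(\log G-\log F\right)ds,$$ where $$K_{1/q}(s)=\begin{cases}\dfrac{s}{p}, & 0\le s\le \dfrac1q,\\[2ex] \dfrac{1-s}{q}, & \dfrac1q\le s\le 1.\end{cases}$$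
   Context: All integrals are with respect to Lebesgue measure $dx$. For $\theta=0$ the integrand $F^{1-\theta}G^\theta$ is read as $F$, and for $\theta=1$ as $G$, so that $Z(0)=\int f^p\,dx$ and $Z(1)=\int g^q\,dx$. $\operatorname{Var}_{\mu}(H)=\int H^2\,d\mu-\left(\int H\,d\mu\right)^2$ denotes the variance of a function $H$ under a probability measure $\mu$.
   Formalization: The formal theorem adds the hypothesis that f and g vanish at the same points up to a null set; without it the identity fails, e.g. n=1, f=1 on [0,2], g=1 on [0,1] (and 0 elsewhere), where the right side is 0 but the left side is (log 2)/p. *)

theory Defs
  imports "HOL-Probability.Probability"
begin

definition Lp_norm :: "real \<Rightarrow> (real ^ 'n \<Rightarrow> real) \<Rightarrow> real" where
  "Lp_norm p f = (\<integral>x. \<bar>f x\<bar> powr p \<partial>lebesgue) powr (1 / p)"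

(* The end point cases are separate because 0 powr 0 = 0: at a point where F > 0 = G, the general
   formula would give 0 instead of F for \<theta> = 0. *)
definition geom_path :: "('a \<Rightarrow> real) \<Rightarrow> ('a \<Rightarrow> real) \<Rightarrow> real \<Rightarrow> 'a \<Rightarrow> real" where
  "geom_path F G \<theta> x =
     (if \<theta> = 0 then F x else if \<theta> = 1 then G x else F x powr (1 - \<theta>) * G x powr \<theta>)"

definition partition_fun :: "(real ^ 'n \<Rightarrow> real) \<Rightarrow> (real ^ 'n \<Rightarrow> real) \<Rightarrow> real \<Rightarrow> real" where
  "partition_fun F G \<theta> = (\<integral>x. geom_path F G \<theta> x \<partial>lebesgue)"

definition path_measure ::
    "(real ^ 'n \<Rightarrow> real) \<Rightarrow> (real ^ 'n \<Rightarrow> real) \<Rightarrow> real \<Rightarrow> (real ^ 'n) measure" where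
  "path_measure F G \<theta> =
     density lebesgue (\<lambda>x. ennreal (geom_path F G \<theta> x / partition_fun F G \<theta>))"

definition Var :: "'a measure \<Rightarrow> ('a \<Rightarrow> real) \<Rightarrow> real" where
  "Var \<mu> H = (\<integral>x. (H x)\<^sup>2 \<partial>\<mu>) - (\<integral>x. H x \<partial>\<mu>)\<^sup>2"

(* K_{1/q}, for p and q conjugate exponents; the two branches agree at s = 1/q. *)
definition interp_kernel :: "real \<Rightarrow> real \<Rightarrow> real \<Rightarrow> real" where
  "interp_kernel p q s = (if s \<le> 1 / q then s / p else (1 - s) / q)"

(* Since ln 0 = 0, this is a junk value where F or G vanishes. If F and G have the same zeros up to
   a null set, that part is negligible for every path_measure F G s with 0 \<le> s \<le> 1. *)
definition log_ratio :: "('a \<Rightarrow> real) \<Rightarrow> ('a \<Rightarrow> real) \<Rightarrow> 'a \<Rightarrow> real" where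
  "log_ratio F G x = ln (G x) - ln (F x)"

end

theory Submission
  imports Defs
begin

text \<open>With \<open>h = ln G - ln F\<close> and \<open>N = F dx\<close> one has \<open>Z(s) = \<integral> exp (s h) dN\<close>, so \<open>Z\<close> is a moment
  generating function. Dominated convergence makes it smooth on the open unit interval and continuous
  on the closed one, and \<open>L = ln Z\<close> satisfies \<open>L'' = Var\<close>. Since \<open>K\<close> is the Green's function of the
  second derivative with pole \<open>1/q\<close>, integrating by parts on both sides of \<open>1/q\<close> turns the integral of
  \<open>K L''\<close> into \<open>L(0)/p + L(1)/q - L(1/q)\<close>. The boundary terms \<open>s L'(s)\<close> and \<open>(1 - s) L'(s)\<close>
  vanish at the end points because \<open>L\<close> is convex and continuous there.\<close>

section \<open>Elementary bounds on exponentials, used as majorants\<close>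

text \<open>The term of index \<open>k\<close> in the series of
  \<open>exp (d * \<bar>y\<bar>)\<close> absorbs the power of \<open>y\<close> at the price of
  enlarging the exponent. Since \<open>d\<close> is at most the distance of \<open>s\<close> to 0
  and to 1, the enlarged exponent is still at most \<open>max 0 y\<close>.\<close>

lemma power_abs_times_exp_le:
  fixes y s d :: real
  assumes "0 < d" "d \<le> s" "d \<le> 1 - s"
  shows "\<bar>y\<bar> ^ k * exp (s * y) \<le> fact k / d ^ k * (1 + exp y)"
proof -
  have "(\<Sum>i\<in>{k}. (d * \<bar>y\<bar>) ^ i /\<^sub>R fact i) \<le> exp (d * \<bar>y\<bar>)"
    unfolding exp_def using assms(1)
    by (intro sum_le_suminf summable_exp_generic) auto
  then have "\<bar>y\<bar> ^ k \<le> fact k / d ^ k * exp (d * \<bar>y\<bar>)"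
    using assms(1) by (simp add: field_simps)
  then have "\<bar>y\<bar> ^ k * exp (s * y) \<le> fact k / d ^ k * exp (d * \<bar>y\<bar>) * exp (s * y)"
    by (intro mult_right_mono) auto
  also have "\<dots> = fact k / d ^ k * exp (d * \<bar>y\<bar> + s * y)"
    by (simp add: exp_add)
  also have "\<dots> \<le> fact k / d ^ k * (1 + exp y)"
  proof (rule mult_left_mono)
    show "exp (d * \<bar>y\<bar> + s * y) \<le> 1 + exp y"
    proof (cases "0 \<le> y")
      case True
      then have "d * y + s * y \<le> 1 * y"
        unfolding distrib_right[symmetric] using assms by (intro mult_right_mono) auto
      then have "exp (d * \<bar>y\<bar> + s * y) \<le> exp y" using True by simp
      then show ?thesis by (simp add: add_increasing)
    next
      case False
      then have "(s - d) * y \<le> 0"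
        using assms by (intro mult_nonneg_nonpos) auto
      then have "exp (d * \<bar>y\<bar> + s * y) \<le> exp 0"
        using False by (simp add: algebra_simps)
      then show ?thesis by (simp add: add_increasing2)
    qed
  qed (use assms in auto)
  finally show ?thesis .
qed

lemma exp_mult_le_between:
  fixes y s a b :: real
  assumes "a \<le> s" "s \<le> b"
  shows "exp (s * y) \<le> exp (a * y) + exp (b * y)"
proof (cases "0 \<le> y")
  case True
  then have "exp (s * y) \<le> exp (b * y)" using assms by (simp add: mult_right_mono)
  then show ?thesis by (simp add: add_increasing)
next
  case False
  then have "exp (s * y) \<le> exp (a * y)" using assms by (simp add: mult_right_mono_neg)
  then show ?thesis by (simp add: add_increasing2)
qed

text \<open>A mean value estimate for \<open>exp\<close>, obtained from the tangent line inequality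
  \<open>1 + u \<le> exp u\<close> applied in both directions.\<close>

lemma abs_exp_diff_le:
  fixes x y c :: real
  assumes "exp x \<le> c" "exp y \<le> c"
  shows "\<bar>exp x - exp y\<bar> \<le> \<bar>x - y\<bar> * c"
proof -
  have *: "exp v - exp u \<le> (v - u) * exp v" for u v :: real
  proof -
    have "exp v * (1 + (u - v)) \<le> exp v * exp (u - v)"
      by (intro mult_left_mono exp_ge_add_one_self) auto
    then show ?thesis by (simp add: algebra_simps flip: exp_add)
  qed
  have **: "exp v - exp u \<le> \<bar>v - u\<bar> * c" if "exp v \<le> c" for u v :: real
  proof -
    have "(v - u) * exp v \<le> \<bar>v - u\<bar> * c"
      using that by (intro mult_mono) auto
    then show ?thesis using *[of v u] by linarith
  qed
  show ?thesis using **[OF assms(1), of y] **[OF assms(2), of x] by (simp add: abs_minus_commute abs_le_iff)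
qed

section \<open>Moment generating functions finite on the closed unit interval\<close>

text \<open>Finiteness of \<open>N\<close> and integrability of \<open>exp h\<close> say that the
  moment generating function of \<open>h\<close> is finite at 0 and at 1, hence in between.\<close>

locale finite_exp_moment = finite_measure N for N :: "'a measure" +
  fixes h :: "'a \<Rightarrow> real"
  assumes h_measurable [measurable]: "h \<in> borel_measurable N"
    and integrable_exp_h: "integrable N (\<lambda>x. exp (h x))"
begin

text \<open>Moments of \<open>h\<close> under the measure with density \<open>exp (s * h)\<close>,
  left unnormalized so that differentiation in \<open>s\<close> just raises \<open>k\<close> by
  one.\<close>

definition moment :: "nat \<Rightarrow> real \<Rightarrow> real" where
  "moment k s = (\<integral>x. h x ^ k * exp (s * h x) \<partial>N)"

lemma integrable_exp_bound: "integrable N (\<lambda>x. C * (1 + exp (h x)))"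
  using integrable_exp_h by (intro integrable_mult_right Bochner_Integration.integrable_add) auto

lemma exp_mult_le_one_plus_exp:
  assumes "s \<in> {0..1}"
  shows "exp (s * h x) \<le> 1 + exp (h x)"
  using exp_mult_le_between[of 0 s 1 "h x"] assms by simp

lemma integrable_exp_mult:
  assumes "s \<in> {0..1}"
  shows "integrable N (\<lambda>x. exp (s * h x))"
  using exp_mult_le_one_plus_exp[OF assms]
  by (intro Bochner_Integration.integrable_bound[OF integrable_exp_bound[of 1]]) auto

lemma integrable_moment_abs:
  assumes "s \<in> {0<..<1}"
  shows "integrable N (\<lambda>x. \<bar>h x\<bar> ^ k * exp (s * h x))"
proof -
  \<comment> \<open>The distance of \<open>s\<close> to the nearer end point. The bound degenerates
    as it tends to 0, which is why only interior \<open>s\<close> are covered.\<close>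
  let ?d = "min s (1 - s)"
  have "norm (\<bar>h x\<bar> ^ k * exp (s * h x)) \<le> norm (fact k / ?d ^ k * (1 + exp (h x)))" for x
    using power_abs_times_exp_le[of ?d s "h x" k] assms by (auto simp: abs_mult)
  then show ?thesis
    by (intro Bochner_Integration.integrable_bound[OF integrable_exp_bound[of "fact k / ?d ^ k"]] AE_I2) auto
qed

lemma integrable_moment:
  assumes "s \<in> {0<..<1}"
  shows "integrable N (\<lambda>x. h x ^ k * exp (s * h x))"
  using integrable_moment_abs[OF assms, of k]
  by (rule Bochner_Integration.integrable_bound) (auto simp: abs_mult power_abs)

text \<open>Differentiation under the integral sign: dominated convergence is applied to the
  difference quotients along an arbitrary sequence tending to \<open>s\<close>.\<close>

lemma has_real_derivative_moment:
  assumes "s \<in> {0<..<1}"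
  shows "(moment k has_real_derivative moment (Suc k) s) (at s)"
proof -
  \<comment> \<open>The midpoints between \<open>s\<close> and the two end points. Absolute moments
    at \<open>a\<close> and \<open>b\<close> are finite, and together they dominate every difference
    quotient taken inside \<open>{a<..<b}\<close>.\<close>
  define a b where "a = s / 2" and "b = (s + 1) / 2"
  have ab: "a \<in> {0<..<1}" "b \<in> {0<..<1}" "s \<in> {a<..<b}" "{a<..<b} \<subseteq> {0<..<1}"
    using assms by (auto simp: a_def b_def)
  have "((\<lambda>t. (moment k t - moment k s) / (t - s)) \<longlongrightarrow> moment (Suc k) s) (at s within {a<..<b})"
    unfolding tendsto_at_iff_sequentially
  proof (intro allI impI)
    fix X assume X: "\<forall>i. X i \<in> {a<..<b} - {s}" and lim: "X \<longlonglongrightarrow> s"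
    let ?Q = "\<lambda>i x. h x ^ k * ((exp (X i * h x) - exp (s * h x)) / (X i - s))"
    have "(\<lambda>i. \<integral>x. ?Q i x \<partial>N) \<longlonglongrightarrow> (\<integral>x. h x ^ Suc k * exp (s * h x) \<partial>N)"
    proof (rule integral_dominated_convergence)
      show "integrable N (\<lambda>x. \<bar>h x\<bar> ^ Suc k * exp (a * h x) + \<bar>h x\<bar> ^ Suc k * exp (b * h x))"
        using ab by (intro Bochner_Integration.integrable_add integrable_moment_abs)
      show "AE x in N. (\<lambda>i. ?Q i x) \<longlonglongrightarrow> h x ^ Suc k * exp (s * h x)"
      proof (rule AE_I2)
        fix x
        have "((\<lambda>t. exp (t * h x)) has_real_derivative h x * exp (s * h x)) (at s)"
          by (auto intro!: derivative_eq_intros)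
        then have "((\<lambda>t. (exp (t * h x) - exp (s * h x)) / (t - s)) \<longlongrightarrow> h x * exp (s * h x)) (at s)"
          by (simp add: has_field_derivative_iff)
        then have "(\<lambda>i. (exp (X i * h x) - exp (s * h x)) / (X i - s)) \<longlonglongrightarrow> h x * exp (s * h x)"
          using X lim unfolding tendsto_at_iff_sequentially comp_def by auto
        then have "(\<lambda>i. ?Q i x) \<longlonglongrightarrow> h x ^ k * (h x * exp (s * h x))"
          by (intro tendsto_intros)
        then show "(\<lambda>i. ?Q i x) \<longlonglongrightarrow> h x ^ Suc k * exp (s * h x)" by (simp add: ac_simps)
      qed
      show "AE x in N. norm (?Q i x) \<le>
          \<bar>h x\<bar> ^ Suc k * exp (a * h x) + \<bar>h x\<bar> ^ Suc k * exp (b * h x)" for i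
      proof (rule AE_I2)
        fix x
        have Xi: "X i \<in> {a<..<b}" "X i \<noteq> s" using X by auto
        let ?E = "exp (a * h x) + exp (b * h x)"
        have "\<bar>exp (X i * h x) - exp (s * h x)\<bar> \<le> \<bar>X i * h x - s * h x\<bar> * ?E"
          using Xi ab by (intro abs_exp_diff_le exp_mult_le_between) auto
        also have "\<dots> = \<bar>X i - s\<bar> * (\<bar>h x\<bar> * ?E)"
          by (simp add: abs_mult flip: left_diff_distrib)
        finally have "\<bar>(exp (X i * h x) - exp (s * h x)) / (X i - s)\<bar> \<le> \<bar>h x\<bar> * ?E"
          using Xi by (simp add: field_simps)
        then have "\<bar>h x\<bar> ^ k * \<bar>(exp (X i * h x) - exp (s * h x)) / (X i - s)\<bar> \<le> \<bar>h x\<bar> ^ k * (\<bar>h x\<bar> * ?E)"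
          by (intro mult_left_mono) auto
        also have "\<dots> = \<bar>h x\<bar> ^ Suc k * exp (a * h x) + \<bar>h x\<bar> ^ Suc k * exp (b * h x)"
          by (simp add: algebra_simps)
        finally show "norm (?Q i x) \<le> \<bar>h x\<bar> ^ Suc k * exp (a * h x) + \<bar>h x\<bar> ^ Suc k * exp (b * h x)"
          unfolding real_norm_def abs_mult power_abs .
      qed
    qed auto
    moreover have "(\<integral>x. ?Q i x \<partial>N) = (moment k (X i) - moment k s) / (X i - s)" for i
    proof -
      have "X i \<in> {0<..<1}" using X ab by blast
      then have "moment k (X i) - moment k s = (\<integral>x. h x ^ k * exp (X i * h x) - h x ^ k * exp (s * h x) \<partial>N)"
        unfolding moment_def using assms by (intro Bochner_Integration.integral_diff[symmetric] integrable_moment)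
      then show ?thesis
        by (simp add: right_diff_distrib flip: integral_divide_zero)
    qed
    ultimately show "((\<lambda>t. (moment k t - moment k s) / (t - s)) \<circ> X) \<longlonglongrightarrow> moment (Suc k) s"
      unfolding comp_def by (simp only: moment_def[of "Suc k" s])
  qed
  then show ?thesis
    using ab(3) by (simp add: has_field_derivative_iff at_within_open[of s "{a<..<b}"])
qed

text \<open>The majorant \<open>1 + exp h\<close> serves for all \<open>s\<close> in the closed
  interval, so for \<open>k = 0\<close> dominated convergence reaches the end points.\<close>

lemma continuous_on_moment_0: "continuous_on {0..1} (moment 0)"
  unfolding continuous_on_eq_continuous_within
proof
  fix s :: real assume s: "s \<in> {0..1}"
  show "continuous (at s within {0..1}) (moment 0)"
    unfolding continuous_within tendsto_at_iff_sequentially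
  proof (intro allI impI)
    fix X assume X: "\<forall>i. X i \<in> {0..1} - {s}" and lim: "X \<longlonglongrightarrow> s"
    have "(\<lambda>i. \<integral>x. exp (X i * h x) \<partial>N) \<longlonglongrightarrow> (\<integral>x. exp (s * h x) \<partial>N)"
      using X exp_mult_le_one_plus_exp lim
      by (intro integral_dominated_convergence[OF _ _ integrable_exp_bound[of 1]])
        (auto intro!: tendsto_intros)
    then show "(moment 0 \<circ> X) \<longlonglongrightarrow> moment 0 s"
      by (simp add: comp_def moment_def)
  qed
qed

lemma moment_0_pos:
  assumes "s \<in> {0..1}" and "emeasure N (space N) \<noteq> 0"
  shows "0 < moment 0 s"
proof -
  have "moment 0 s \<noteq> 0"
  proof
    assume "moment 0 s = 0"
    then have "AE x in N. exp (s * h x) = 0"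
      using integral_nonneg_eq_0_iff_AE[OF integrable_exp_mult[OF assms(1)]] by (simp add: moment_def)
    then have "AE x in N. \<not> True" by simp
    then show False using emeasure_eq_0_AE[of "\<lambda>_. True" N] assms(2) by simp
  qed
  moreover have "0 \<le> moment 0 s" by (simp add: moment_def)
  ultimately show ?thesis by simp
qed

definition log_mgf :: "real \<Rightarrow> real" where
  "log_mgf s = ln (moment 0 s)"

definition tilted_mean :: "real \<Rightarrow> real" where
  "tilted_mean s = moment 1 s / moment 0 s"

definition tilted_variance :: "real \<Rightarrow> real" where
  "tilted_variance s = moment 2 s / moment 0 s - (tilted_mean s)\<^sup>2"

text \<open>Expanding the integral of the squared deviation from the tilted mean gives
  \<open>moment 0 s\<close> times the variance. This makes \<open>log_mgf\<close> convex.\<close>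

lemma tilted_variance_nonneg:
  assumes s: "s \<in> {0<..<1}" and N: "emeasure N (space N) \<noteq> 0"
  shows "0 \<le> tilted_variance s"
proof -
  let ?m = "tilted_mean s"
  have pos: "0 < moment 0 s" using moment_0_pos[OF _ N] s by auto
  have "0 \<le> (\<integral>x. (h x - ?m)\<^sup>2 * exp (s * h x) \<partial>N)" by simp
  also have "\<dots> = (\<integral>x. h x ^ 2 * exp (s * h x) - 2 * ?m * (h x ^ 1 * exp (s * h x))
      + ?m\<^sup>2 * (h x ^ 0 * exp (s * h x)) \<partial>N)"
    by (intro Bochner_Integration.integral_cong) (auto simp: power2_eq_square algebra_simps)
  also have "\<dots> = moment 2 s - 2 * ?m * moment 1 s + ?m\<^sup>2 * moment 0 s"
    unfolding moment_def using integrable_moment[OF s, of 0] integrable_moment[OF s, of 1] integrable_moment[OF s, of 2]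
    by (subst Bochner_Integration.integral_add Bochner_Integration.integral_diff, simp, simp)+ simp
  also have "\<dots> = moment 0 s * tilted_variance s"
    using pos by (simp add: tilted_variance_def tilted_mean_def field_simps power2_eq_square)
  finally show ?thesis using pos by (simp add: zero_le_mult_iff)
qed

lemma has_real_derivative_log_mgf:
  assumes s: "s \<in> {0<..<1}" and N: "emeasure N (space N) \<noteq> 0"
  shows "(log_mgf has_real_derivative tilted_mean s) (at s)"
proof -
  have "0 < moment 0 s" using moment_0_pos[OF _ N] s by auto
  then show ?thesis
    unfolding log_mgf_def[abs_def] tilted_mean_def
    using has_real_derivative_moment[OF s, of 0]
    by (auto intro!: derivative_eq_intros)
qed

lemma has_real_derivative_tilted_mean:
  assumes s: "s \<in> {0<..<1}" and N: "emeasure N (space N) \<noteq> 0"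
  shows "(tilted_mean has_real_derivative tilted_variance s) (at s)"
proof -
  have "0 < moment 0 s" using moment_0_pos[OF _ N] s by auto
  then show ?thesis
    unfolding tilted_mean_def[abs_def] tilted_variance_def
    using has_real_derivative_moment[OF s, of 0] has_real_derivative_moment[OF s, of 1]
    by (auto intro!: derivative_eq_intros simp: field_simps power2_eq_square numeral_2_eq_2)
qed

lemma isCont_tilted_variance:
  assumes s: "s \<in> {0<..<1}" and N: "emeasure N (space N) \<noteq> 0"
  shows "isCont tilted_variance s"
proof -
  have "0 < moment 0 s" using moment_0_pos[OF _ N] s by auto
  moreover have "isCont (moment k) s" for k
    using has_real_derivative_moment[OF s] by (rule DERIV_isCont)
  ultimately show ?thesis
    unfolding tilted_variance_def[abs_def] tilted_mean_def by (intro continuous_intros) auto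
qed

lemma continuous_on_log_mgf:
  assumes N: "emeasure N (space N) \<noteq> 0"
  shows "continuous_on {0..1} log_mgf"
  unfolding log_mgf_def[abs_def] using continuous_on_moment_0 moment_0_pos[OF _ N]
  by (intro continuous_on_ln) (auto simp: less_imp_neq[symmetric])

end


section \<open>Integration of the Green kernel against the second derivative of a convex
  function\<close>

text \<open>For a nonnegative integrand, finite limits of the antiderivative at the ends already
  yield integrability, so no bound on \<open>f\<close> near \<open>a\<close> or \<open>b\<close> has
  to be known beforehand.\<close>

lemma set_integral_FTC_nonneg:
  fixes f F :: "real \<Rightarrow> real" and a b A B :: real
  assumes "a < b"
    and "\<And>x. x \<in> {a<..<b} \<Longrightarrow> (F has_real_derivative f x) (at x)"
    and "\<And>x. x \<in> {a<..<b} \<Longrightarrow> isCont f x"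
    and "\<And>x. x \<in> {a<..<b} \<Longrightarrow> 0 \<le> f x"
    and "(F \<longlongrightarrow> A) (at_right a)" and "(F \<longlongrightarrow> B) (at_left b)"
  shows "set_integrable lborel {a<..<b} f \<and> (LINT x:{a<..<b}|lborel. f x) = B - A"
proof -
  have "set_integrable lborel (einterval a b) f" "(LBINT x=a..b. f x) = B - A"
    by (rule interval_integral_FTC_nonneg; use assms in \<open>simp add: ereal_tendsto_simps\<close>)+
  then show ?thesis
    using assms(1) by (simp_all add: interval_lebesgue_integral_def)
qed

text \<open>At the end points only continuity of \<open>L\<close> is demanded; \<open>L'\<close> and
  \<open>L''\<close> may blow up there, as can happen for \<open>log_mgf\<close>.\<close>

locale convex_C2_unit =
  fixes L L' L'' :: "real \<Rightarrow> real"
  assumes continuous: "continuous_on {0..1} L"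
    and deriv1: "\<And>s. s \<in> {0<..<1} \<Longrightarrow> (L has_real_derivative L' s) (at s)"
    and deriv2: "\<And>s. s \<in> {0<..<1} \<Longrightarrow> (L' has_real_derivative L'' s) (at s)"
    and deriv2_cont: "\<And>s. s \<in> {0<..<1} \<Longrightarrow> isCont L'' s"
    and deriv2_nonneg: "\<And>s. s \<in> {0<..<1} \<Longrightarrow> 0 \<le> L'' s"
begin

text \<open>The symmetry of the interval carries the boundary analysis at 0 over to 1.\<close>

lemma reflect: "convex_C2_unit (\<lambda>s. L (1 - s)) (\<lambda>s. - L' (1 - s)) (\<lambda>s. L'' (1 - s))"
proof
  show "continuous_on {0..1} (\<lambda>s. L (1 - s))"
    by (rule continuous_on_compose2[OF continuous]) (auto intro!: continuous_intros)
next
  fix s :: real assume s: "s \<in> {0<..<1}"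
  then have s': "1 - s \<in> {0<..<1}" by auto
  show "((\<lambda>s. L (1 - s)) has_real_derivative - L' (1 - s)) (at s)"
    by (rule DERIV_cong[OF DERIV_chain2[where f = L and g = "\<lambda>s. 1 - s", OF deriv1[OF s']]])
      (auto intro!: derivative_eq_intros)
  show "((\<lambda>s. - L' (1 - s)) has_real_derivative L'' (1 - s)) (at s)"
    by (rule DERIV_cong[OF DERIV_minus[OF DERIV_chain2[where f = L' and g = "\<lambda>s. 1 - s", OF deriv2[OF s']]]])
      (auto intro!: derivative_eq_intros)
  show "isCont (\<lambda>s. L'' (1 - s)) s"
    by (rule isCont_o2[where f = "\<lambda>s. 1 - s"]) (use deriv2_cont[OF s'] in \<open>auto intro!: continuous_intros\<close>)
  show "0 \<le> L'' (1 - s)" using deriv2_nonneg[OF s'] .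
qed

lemma deriv1_mono:
  assumes "0 < s" "s \<le> t" "t < 1"
  shows "L' s \<le> L' t"
proof (rule DERIV_nonneg_imp_nondecreasing[OF assms(2)])
  show "\<exists>y. (L' has_real_derivative y) (at x) \<and> 0 \<le> y" if "s \<le> x" "x \<le> t" for x
    using deriv2[of x] deriv2_nonneg[of x] that assms by auto
qed

text \<open>The mean value theorem writes the chord slope as \<open>L' z\<close> with
  \<open>z\<close> between \<open>s\<close> and \<open>t\<close>, and \<open>L'\<close> is
  monotone.\<close>

lemma chord_le:
  assumes "0 \<le> s" "s < t" "t \<le> 1"
  shows "t < 1 \<Longrightarrow> L t - L s \<le> (t - s) * L' t"
    and "0 < s \<Longrightarrow> (t - s) * L' s \<le> L t - L s"
proof -
  have "continuous_on {s..t} L"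
    using assms by (intro continuous_on_subset[OF continuous]) auto
  moreover have "L differentiable (at x)" if "s < x" "x < t" for x
    using deriv1[of x] that assms by (auto simp: real_differentiable_def)
  ultimately obtain l z where z: "s < z" "z < t" "(L has_real_derivative l) (at z)" "L t - L s = (t - s) * l"
    using MVT[OF assms(2)] by blast
  have l: "l = L' z" using DERIV_unique[OF z(3) deriv1[of z]] z assms by auto
  show "L t - L s \<le> (t - s) * L' t" if "t < 1"
    using deriv1_mono[of z t] z assms l that by (auto intro!: mult_left_mono)
  show "(t - s) * L' s \<le> L t - L s" if "0 < s"
    using deriv1_mono[of s z] z assms l that by (auto intro!: mult_left_mono)
qed

lemma tendsto_L_0: "(L \<longlongrightarrow> L 0) (at_right 0)"
  using continuous_on_Icc_at_rightD[OF continuous] by simp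

text \<open>By convexity \<open>s L'(s)\<close> lies between \<open>L(s) - L(0)\<close> and \<open>L(2s) - L(s)\<close>, so it vanishes at the
  end point although \<open>L'\<close> may be unbounded there.\<close>

lemma tendsto_mult_deriv_0: "((\<lambda>s. s * L' s) \<longlongrightarrow> 0) (at_right 0)"
proof (rule tendsto_sandwich)
  have ev: "eventually (\<lambda>s. s \<in> {0<..<1/2}) (at_right (0::real))"
    by (rule eventually_at_right_real) simp
  show "eventually (\<lambda>s. L s - L 0 \<le> s * L' s) (at_right 0)"
    using ev by eventually_elim (use chord_le(1)[of 0] in auto)
  show "eventually (\<lambda>s. s * L' s \<le> L (2 * s) - L s) (at_right 0)"
  proof (use ev in eventually_elim)
    fix s :: real assume "s \<in> {0<..<1/2}"
    then show "s * L' s \<le> L (2 * s) - L s" using chord_le(2)[of s "2 * s"] by auto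
  qed
  show "((\<lambda>s. L s - L 0) \<longlongrightarrow> 0) (at_right 0)"
    using tendsto_diff[OF tendsto_L_0 tendsto_const[of "L 0"]] by simp
  have "filterlim (\<lambda>s. 2 * s :: real) (at_right 0) (at_right 0)"
    unfolding filterlim_at using ev
    by (auto intro!: tendsto_eq_intros eventually_mono[OF ev])
  from filterlim_compose[OF tendsto_L_0 this] show "((\<lambda>s. L (2 * s) - L s) \<longlongrightarrow> 0) (at_right 0)"
    using tendsto_diff[OF _ tendsto_L_0] by fastforce
qed

lemma tendsto_L_1: "(L \<longlongrightarrow> L 1) (at_left 1)"
  using continuous_on_Icc_at_leftD[OF continuous] by simp

text \<open>The limit at 0 for the reflected function; the sign change of its derivative accounts
  for \<open>tendsto_minus\<close>.\<close>

lemma tendsto_mult_deriv_1: "((\<lambda>s. (1 - s) * L' s) \<longlongrightarrow> 0) (at_left 1)"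
  using tendsto_minus[OF convex_C2_unit.tendsto_mult_deriv_0[OF reflect]]
  unfolding filterlim_at_left_to_right filterlim_at_right_to_0[of _ _ "-1"] by simp

text \<open>Integration by parts on each side of \<open>a = 1 / q\<close>. The kernel is continuous
  at \<open>a\<close>, so the two terms with \<open>L' a\<close> cancel; its slope drops from
  \<open>1 - a\<close> to \<open>- a\<close>, which leaves exactly \<open>- L a\<close>.\<close>

lemma interp_kernel_integral:
  assumes p: "1 < p" and q: "1 < q" and pq: "1 / p + 1 / q = 1"
  shows "set_integrable lborel {0..1} (\<lambda>s. interp_kernel p q s * L'' s)"
    and "(LINT s:{0..1}|lborel. interp_kernel p q s * L'' s) = L 0 / p + L 1 / q - L (1 / q)"
proof -
  define a where "a = 1 / q"
  let ?K = "\<lambda>s. interp_kernel p q s * L'' s"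
  have a: "0 < a" "a < 1" and p_eq: "1 / p = 1 - a" using p q pq by (auto simp: a_def)
  have K: "interp_kernel p q s = (if s \<le> a then (1 - a) * s else a * (1 - s))" for s
    unfolding interp_kernel_def p_eq[symmetric] by (simp add: a_def)
  have tendsto_a: "(L \<longlongrightarrow> L a) (at a within S)" "(L' \<longlongrightarrow> L' a) (at a within S)" for S
    using DERIV_isCont[OF deriv1[of a]] DERIV_isCont[OF deriv2[of a]] a
    by (auto simp flip: continuous_within intro: continuous_at_imp_continuous_at_within)
  have "set_integrable lborel {0<..<a} (\<lambda>s. (1 - a) * (s * L'' s)) \<and>
    (LINT s:{0<..<a}|lborel. (1 - a) * (s * L'' s)) = (1 - a) * (a * L' a - L a) - (1 - a) * (0 - L 0)"
  \<comment> \<open>\<open>s * L' - L\<close> is the antiderivative of \<open>s * L''\<close>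
    produced by integrating by parts.\<close>
  proof (rule set_integral_FTC_nonneg[where F = "\<lambda>s. (1 - a) * (s * L' s - L s)"])
    fix s assume "s \<in> {0<..<a}"
    then have s: "s \<in> {0<..<1}" "0 \<le> s" using a by auto
    show "((\<lambda>s. (1 - a) * (s * L' s - L s)) has_real_derivative (1 - a) * (s * L'' s)) (at s)"
      by (rule derivative_eq_intros deriv1[OF s(1)] deriv2[OF s(1)] refl)+ (simp add: algebra_simps)
    show "isCont (\<lambda>s. (1 - a) * (s * L'' s)) s"
      using deriv2_cont[OF s(1)] by (intro continuous_intros)
    show "0 \<le> (1 - a) * (s * L'' s)"
      using deriv2_nonneg[OF s(1)] s a by (intro mult_nonneg_nonneg) auto
  next
    show "((\<lambda>s. (1 - a) * (s * L' s - L s)) \<longlongrightarrow> (1 - a) * (0 - L 0)) (at_right 0)"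
      by (intro tendsto_intros tendsto_mult_deriv_0 tendsto_L_0)
    show "((\<lambda>s. (1 - a) * (s * L' s - L s)) \<longlongrightarrow> (1 - a) * (a * L' a - L a)) (at_left a)"
      by (intro tendsto_intros tendsto_a)
  qed (rule a)
  moreover have "set_integrable lborel {0<..<a} (\<lambda>s. (1 - a) * (s * L'' s)) = set_integrable lborel {0<..<a} ?K"
    by (rule set_integrable_cong) (simp_all add: K)
  moreover have "(LINT s:{0<..<a}|lborel. (1 - a) * (s * L'' s)) = (LINT s:{0<..<a}|lborel. ?K s)"
    by (rule set_lebesgue_integral_cong) (simp_all add: K)
  ultimately have left: "set_integrable lborel {0<..<a} ?K"
    "(LINT s:{0<..<a}|lborel. ?K s) = (1 - a) * (a * L' a - L a) - (1 - a) * (0 - L 0)"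
    by metis+
  have "set_integrable lborel {a<..<1} (\<lambda>s. a * ((1 - s) * L'' s)) \<and>
    (LINT s:{a<..<1}|lborel. a * ((1 - s) * L'' s)) = a * (0 + L 1) - a * ((1 - a) * L' a + L a)"
  \<comment> \<open>Here the weight \<open>1 - s\<close> decreases, so \<open>L\<close> enters with
    a plus sign.\<close>
  proof (rule set_integral_FTC_nonneg[where F = "\<lambda>s. a * ((1 - s) * L' s + L s)"])
    fix s assume "s \<in> {a<..<1}"
    then have s: "s \<in> {0<..<1}" "s \<le> 1" using a by auto
    show "((\<lambda>s. a * ((1 - s) * L' s + L s)) has_real_derivative a * ((1 - s) * L'' s)) (at s)"
      by (rule derivative_eq_intros deriv1[OF s(1)] deriv2[OF s(1)] refl)+ (simp add: algebra_simps)
    show "isCont (\<lambda>s. a * ((1 - s) * L'' s)) s"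
      using deriv2_cont[OF s(1)] by (intro continuous_intros)
    show "0 \<le> a * ((1 - s) * L'' s)"
      using deriv2_nonneg[OF s(1)] s a by (intro mult_nonneg_nonneg) auto
  next
    show "((\<lambda>s. a * ((1 - s) * L' s + L s)) \<longlongrightarrow> a * (0 + L 1)) (at_left 1)"
      by (intro tendsto_intros tendsto_mult_deriv_1 tendsto_L_1)
    show "((\<lambda>s. a * ((1 - s) * L' s + L s)) \<longlongrightarrow> a * ((1 - a) * L' a + L a)) (at_right a)"
      by (intro tendsto_intros tendsto_a)
  qed (rule a)
  moreover have "set_integrable lborel {a<..<1} (\<lambda>s. a * ((1 - s) * L'' s)) = set_integrable lborel {a<..<1} ?K"
    by (rule set_integrable_cong) (simp_all add: K)
  moreover have "(LINT s:{a<..<1}|lborel. a * ((1 - s) * L'' s)) = (LINT s:{a<..<1}|lborel. ?K s)"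
    by (rule set_lebesgue_integral_cong) (simp_all add: K)
  ultimately have right: "set_integrable lborel {a<..<1} ?K"
    "(LINT s:{a<..<1}|lborel. ?K s) = a * (0 + L 1) - a * ((1 - a) * L' a + L a)"
    by metis+
  let ?U = "{0<..<a} \<union> {a<..<1}"
  \<comment> \<open>The two open pieces miss only three points of the closed interval, a null
    set.\<close>
  have diff: "({0..1} - ?U) \<union> (?U - {0..1}) \<subseteq> {0, a, 1}" using a by auto
  have "set_integrable lborel ?U ?K"
    using left(1) right(1) by (rule set_integrable_Un) auto
  then show "set_integrable lborel {0..1} ?K"
    by (subst set_integrable_discrete_difference[OF _ diff]) auto
  have "(LINT s:{0..1}|lborel. ?K s) = (LINT s:?U|lborel. ?K s)"
    by (rule set_integral_discrete_difference[OF _ diff]) auto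
  also have "\<dots> = (LINT s:{0<..<a}|lborel. ?K s) + (LINT s:{a<..<1}|lborel. ?K s)"
    using left(1) right(1) by (intro set_integral_Un) auto
  also have "\<dots> = (1 - a) * L 0 + a * L 1 - L a"
    unfolding left(2) right(2) by (simp add: algebra_simps)
  also have "\<dots> = 1 / p * L 0 + 1 / q * L 1 - L (1 / q)"
    unfolding p_eq by (simp add: a_def)
  finally show "(LINT s:{0..1}|lborel. ?K s) = L 0 / p + L 1 / q - L (1 / q)" by simp
qed

end

section \<open>The geometric path between two densities as an exponential family\<close>

locale density_pair =
  fixes F G :: "real ^ 'n \<Rightarrow> real"
  assumes integrable_F: "integrable lebesgue F" and integrable_G: "integrable lebesgue G"
    and F_nonneg: "\<And>x. 0 \<le> F x" and G_nonneg: "\<And>x. 0 \<le> G x"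
    and same_zeros: "AE x in lebesgue. F x = 0 \<longleftrightarrow> G x = 0"
    and integral_F_pos: "0 < (\<integral>x. F x \<partial>lebesgue)"
begin

abbreviation N :: "(real ^ 'n) measure" where
  "N \<equiv> density lebesgue (\<lambda>x. ennreal (F x))"

lemma F_measurable [measurable]: "F \<in> borel_measurable lebesgue"
  and G_measurable [measurable]: "G \<in> borel_measurable lebesgue"
  using integrable_F integrable_G by auto

lemma log_ratio_measurable [measurable]: "log_ratio F G \<in> borel_measurable lebesgue"
  unfolding log_ratio_def[abs_def] by measurable

lemma geom_path_measurable [measurable]: "geom_path F G \<theta> \<in> borel_measurable lebesgue"
  unfolding geom_path_def[abs_def] by measurable

lemma geom_path_nonneg: "0 \<le> geom_path F G \<theta> x"
  using F_nonneg G_nonneg by (simp add: geom_path_def)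

text \<open>Where both densities are positive this is a computation with logarithms. Where both
  vanish, both sides are 0 whatever value \<open>log_ratio\<close> takes, and
  \<open>same_zeros\<close> leaves only a null set besides.\<close>

lemma geom_path_eq_exp_log_ratio:
  "AE x in lebesgue. geom_path F G \<theta> x = F x * exp (\<theta> * log_ratio F G x)"
  using same_zeros
proof eventually_elim
  fix x assume zeros: "F x = 0 \<longleftrightarrow> G x = 0"
  show "geom_path F G \<theta> x = F x * exp (\<theta> * log_ratio F G x)"
  proof (cases "F x = 0")
    case True
    then show ?thesis using zeros by (simp add: geom_path_def)
  next
    case False
    then have pos: "0 < F x" "0 < G x"
      using zeros F_nonneg[of x] G_nonneg[of x] by auto
    have "F x * exp (\<theta> * log_ratio F G x) = exp (ln (F x) + \<theta> * log_ratio F G x)"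
      using pos by (simp add: exp_add)
    also have "ln (F x) + \<theta> * log_ratio F G x = (1 - \<theta>) * ln (F x) + \<theta> * ln (G x)"
      by (simp add: log_ratio_def algebra_simps)
    also have "exp \<dots> = F x powr (1 - \<theta>) * G x powr \<theta>"
      using pos by (simp add: powr_def exp_add)
    finally show ?thesis using pos by (simp add: geom_path_def)
  qed
qed

text \<open>Transfers integrability between the tilted form and the path. The factor
  \<open>H\<close> will be 1 or a power of \<open>log_ratio F G\<close>.\<close>

lemma integrable_N_iff:
  fixes H :: "real ^ 'n \<Rightarrow> real"
  assumes [measurable]: "H \<in> borel_measurable lebesgue"
  shows "integrable N (\<lambda>x. exp (\<theta> * log_ratio F G x) * H x :: real)
    \<longleftrightarrow> integrable lebesgue (\<lambda>x. geom_path F G \<theta> x * H x)"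
proof -
  have "integrable N (\<lambda>x. exp (\<theta> * log_ratio F G x) * H x)
    \<longleftrightarrow> integrable lebesgue (\<lambda>x. F x *\<^sub>R (exp (\<theta> * log_ratio F G x) * H x))"
    by (rule integrable_density) (simp_all add: F_nonneg)
  also have "\<dots> \<longleftrightarrow> integrable lebesgue (\<lambda>x. geom_path F G \<theta> x * H x)"
  proof (rule integrable_cong_AE)
    show "AE x in lebesgue. F x *\<^sub>R (exp (\<theta> * log_ratio F G x) * H x) = geom_path F G \<theta> x * H x"
      using geom_path_eq_exp_log_ratio[of \<theta>] by eventually_elim simp
  qed measurable
  finally show ?thesis .
qed

lemma integral_N:
  fixes H :: "real ^ 'n \<Rightarrow> real"
  assumes [measurable]: "H \<in> borel_measurable lebesgue"
  shows "(\<integral>x. exp (\<theta> * log_ratio F G x) * H x \<partial>N) = (\<integral>x. geom_path F G \<theta> x * H x \<partial>lebesgue)"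
proof -
  have "(\<integral>x. exp (\<theta> * log_ratio F G x) * H x \<partial>N)
    = (\<integral>x. F x *\<^sub>R (exp (\<theta> * log_ratio F G x) * H x) \<partial>lebesgue)"
    by (rule integral_density) (simp_all add: F_nonneg)
  also have "\<dots> = (\<integral>x. geom_path F G \<theta> x * H x \<partial>lebesgue)"
  proof (rule integral_cong_AE)
    show "AE x in lebesgue. F x *\<^sub>R (exp (\<theta> * log_ratio F G x) * H x) = geom_path F G \<theta> x * H x"
      using geom_path_eq_exp_log_ratio[of \<theta>] by eventually_elim simp
  qed measurable
  finally show ?thesis .
qed

lemma emeasure_N: "emeasure N (space N) = ennreal (\<integral>x. F x \<partial>lebesgue)"
  using integrable_F F_nonneg
  by (simp add: emeasure_density nn_integral_eq_integral)

sublocale finite_exp_moment N "log_ratio F G"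
proof (intro finite_exp_moment.intro finite_exp_moment_axioms.intro finite_measureI)
  show "emeasure N (space N) \<noteq> \<infinity>" unfolding emeasure_N by simp
  show "log_ratio F G \<in> borel_measurable N" by simp
  show "integrable N (\<lambda>x. exp (log_ratio F G x))"
    \<comment> \<open>At parameter 1 the path is \<open>G\<close>, so this is the integrability of
      \<open>G\<close>.\<close>
    using integrable_N_iff[of "\<lambda>_. 1" 1] integrable_G by (simp add: geom_path_def)
qed

lemma N_nonzero: "emeasure N (space N) \<noteq> 0"
  using integral_F_pos unfolding emeasure_N by simp

lemma partition_fun_eq_moment: "partition_fun F G \<theta> = moment 0 \<theta>"
  using integral_N[of "\<lambda>_. 1" \<theta>] by (simp add: partition_fun_def moment_def)

lemma partition_fun_pos: "\<theta> \<in> {0..1} \<Longrightarrow> 0 < partition_fun F G \<theta>"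
  using moment_0_pos[OF _ N_nonzero] by (simp add: partition_fun_eq_moment)

lemma prob_space_path_measure:
  assumes \<theta>: "\<theta> \<in> {0..1}"
  shows "prob_space (path_measure F G \<theta>)"
proof
  have "integrable lebesgue (geom_path F G \<theta>)"
    using integrable_N_iff[of "\<lambda>_. 1" \<theta>] integrable_exp_mult[OF \<theta>] by simp
  then have "(\<integral>\<^sup>+x. ennreal (geom_path F G \<theta> x / partition_fun F G \<theta>) \<partial>lebesgue)
      = ennreal (\<integral>x. geom_path F G \<theta> x / partition_fun F G \<theta> \<partial>lebesgue)"
    using partition_fun_pos[OF \<theta>] geom_path_nonneg
    by (intro nn_integral_eq_integral) auto
  also have "\<dots> = 1"
    using partition_fun_pos[OF \<theta>] by (simp flip: partition_fun_def)
  finally show "emeasure (path_measure F G \<theta>) (space (path_measure F G \<theta>)) = 1"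
    by (simp add: path_measure_def emeasure_density)
qed

lemma integrable_path_measure:
  assumes s: "s \<in> {0<..<1}"
  shows "integrable (path_measure F G s) (\<lambda>x. log_ratio F G x ^ k)"
proof -
  have pos: "0 < partition_fun F G s" using partition_fun_pos s by auto
  have "integrable lebesgue (\<lambda>x. geom_path F G s x * log_ratio F G x ^ k)"
    using integrable_N_iff[of "\<lambda>x. log_ratio F G x ^ k" s] integrable_moment[OF s, of k]
    by (simp add: mult.commute)
  then show ?thesis
    unfolding path_measure_def using pos geom_path_nonneg
    by (subst integrable_density) auto
qed

lemma integral_path_measure:
  assumes s: "s \<in> {0<..<1}"
  shows "(\<integral>x. log_ratio F G x ^ k \<partial>path_measure F G s) = moment k s / moment 0 s"
proof -
  have pos: "0 < partition_fun F G s" using partition_fun_pos s by auto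
  have "(\<integral>x. log_ratio F G x ^ k \<partial>path_measure F G s)
    = (\<integral>x. geom_path F G s x * log_ratio F G x ^ k / partition_fun F G s \<partial>lebesgue)"
    unfolding path_measure_def using pos geom_path_nonneg
    by (subst integral_density) auto
  also have "\<dots> = moment k s / moment 0 s"
    using integral_N[of "\<lambda>x. log_ratio F G x ^ k" s]
    by (simp add: partition_fun_eq_moment moment_def mult.commute)
  finally show ?thesis .
qed

lemma Var_path_measure:
  assumes "s \<in> {0<..<1}"
  shows "Var (path_measure F G s) (log_ratio F G) = tilted_variance s"
  using integral_path_measure[OF assms, of 1] integral_path_measure[OF assms, of 2]
  by (simp add: Var_def tilted_variance_def tilted_mean_def)

sublocale convex_C2_unit log_mgf tilted_mean tilted_variance
  by unfold_locales (intro continuous_on_log_mgf has_real_derivative_log_mgf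
    has_real_derivative_tilted_mean isCont_tilted_variance tilted_variance_nonneg N_nonzero; assumption)+

text \<open>At 0 and 1 the log ratio need not be square integrable and \<open>Var\<close> may
  consist of default values, but the kernel vanishes there.\<close>

lemma interp_kernel_Var:
  assumes "1 < p" "1 < q" "s \<in> {0..1}"
  shows "interp_kernel p q s * tilted_variance s
    = interp_kernel p q s * Var (path_measure F G s) (log_ratio F G)"
proof (cases "s \<in> {0<..<1}")
  case True
  then show ?thesis by (simp add: Var_path_measure)
next
  case False
  then have "s = 0 \<or> s = 1" using assms by auto
  then have "interp_kernel p q s = 0" using assms by (auto simp: interp_kernel_def)
  then show ?thesis by simp
qed

end

section \<open>The deficit in Hoelder's inequality\<close>

text \<open>The condition on the zeros of \<open>f\<close> and \<open>g\<close> makes the log ratio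
  meaningful almost everywhere for each path measure. If \<open>F > 0 = G\<close> on a set of
  positive measure, \<open>partition_fun F G\<close> would jump at 0. The first three conjuncts
  certify that the integrals in the identity are genuine and not default values.\<close>

theorem theorem3p1:
  fixes p q :: real
    and f g F G :: "real ^ 'n \<Rightarrow> real"
  assumes "1 < p" and "1 < q" and "1 / p + 1 / q = 1"
    and "f \<in> borel_measurable lebesgue" and "g \<in> borel_measurable lebesgue"
    and "\<And>x. 0 \<le> f x" and "\<And>x. 0 \<le> g x"
    and "integrable lebesgue (\<lambda>x. f x powr p)" and "0 < (\<integral>x. f x powr p \<partial>lebesgue)"
    and "integrable lebesgue (\<lambda>x. g x powr q)" and "0 < (\<integral>x. g x powr q \<partial>lebesgue)"
    and "AE x in lebesgue. f x = 0 \<longleftrightarrow> g x = 0"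
  defines "F \<equiv> (\<lambda>x. f x powr p)" and "G \<equiv> (\<lambda>x. g x powr q)"
  shows "(\<forall>\<theta>\<in>{0..1}. prob_space (path_measure F G \<theta>))
    \<and> (\<forall>s\<in>{0<..<1}. integrable (path_measure F G s) (log_ratio F G)
           \<and> integrable (path_measure F G s) (\<lambda>x. (log_ratio F G x)\<^sup>2))
    \<and> set_integrable lborel {0..1}
        (\<lambda>s. interp_kernel p q s * Var (path_measure F G s) (log_ratio F G))
    \<and> ln (Lp_norm p f * Lp_norm q g / (\<integral>x. f x * g x \<partial>lebesgue))
        = (LINT s:{0..1}|lborel. interp_kernel p q s * Var (path_measure F G s) (log_ratio F G))"
proof -
  interpret density_pair F G
    using assms by unfold_locales (auto simp: F_def G_def)
  have q_inv: "1 / q \<in> {0..1}" using assms(2) by auto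
  have norm_f: "Lp_norm p f = partition_fun F G 0 powr (1 / p)"
    and norm_g: "Lp_norm q g = partition_fun F G 1 powr (1 / q)"
    using assms(6,7) by (simp_all add: Lp_norm_def partition_fun_def geom_path_def F_def G_def)
  \<comment> \<open>As \<open>1 / q\<close> lies strictly between 0 and 1, the general branch
    applies, and its exponents \<open>1 / p\<close> and \<open>1 / q\<close> undo the powers
    \<open>p\<close> and \<open>q\<close>.\<close>
  have "f x * g x = geom_path F G (1 / q) x" for x
  proof -
    have "1 - 1 / q = 1 / p" using assms(3) by simp
    then show ?thesis
      using assms(1,2,6,7) by (simp add: geom_path_def F_def G_def powr_powr)
  qed
  then have fg: "(\<integral>x. f x * g x \<partial>lebesgue) = partition_fun F G (1 / q)"
    by (simp add: partition_fun_def)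
  have "ln (Lp_norm p f * Lp_norm q g / (\<integral>x. f x * g x \<partial>lebesgue))
      = log_mgf 0 / p + log_mgf 1 / q - log_mgf (1 / q)"
    using partition_fun_pos[of 0] partition_fun_pos[of 1] partition_fun_pos[OF q_inv]
    unfolding norm_f norm_g fg
    by (simp add: ln_div ln_mult ln_powr log_mgf_def partition_fun_eq_moment)
  also have "\<dots> = (LINT s:{0..1}|lborel. interp_kernel p q s * tilted_variance s)"
    using interp_kernel_integral(2)[OF assms(1-3)] by simp
  also have "\<dots> = (LINT s:{0..1}|lborel. interp_kernel p q s * Var (path_measure F G s) (log_ratio F G))"
    by (intro set_lebesgue_integral_cong allI impI interp_kernel_Var assms(1,2)) auto
  finally have eq: "ln (Lp_norm p f * Lp_norm q g / (\<integral>x. f x * g x \<partial>lebesgue)) = \<dots>" .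
  have "set_integrable lborel {0..1} (\<lambda>s. interp_kernel p q s * tilted_variance s)
      = set_integrable lborel {0..1} (\<lambda>s. interp_kernel p q s * Var (path_measure F G s) (log_ratio F G))"
    by (intro set_integrable_cong refl interp_kernel_Var assms(1,2))
  with interp_kernel_integral(1)[OF assms(1-3)]
  have "set_integrable lborel {0..1} (\<lambda>s. interp_kernel p q s * Var (path_measure F G s) (log_ratio F G))"
    by simp
  then show ?thesis
    using eq prob_space_path_measure integrable_path_measure[of _ 1] integrable_path_measure[of _ 2]
    by simp
qed

end
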